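(* Let $c,d\in\mathbb{Z}$ be such that $g(x)=x^5+cx^4+d$ is irreducible in $\mathbb{Z}[x]$, and let $\theta$ be a root of $g$. Suppose that $\dfrac{5^5d+2^8c^5}{\gcd(5^5d,\,2^8c^5)}$ is square-free. Then $\mathbb{Z}[\theta]$ is the full ring of integers of $\mathbb{Q}(\theta)$ if and only if $d$ is square-free and, in the case $5\mid c$ and $5\nmid d$, $c+d\not\equiv 1,7,18,24\pmod{25}$. *)

theory Defs
  imports Complex_Main "HOL-Computational_Algebra.Polynomial" "HOL-Computational_Algebra.Squarefree"
begin

definition rat_field_gen :: "complex \<Rightarrow> complex set" where
  "rat_field_gen \<theta> = {poly (map_poly of_rat p) \<theta> / poly (map_poly of_rat q) \<theta> | p q.
       poly (map_poly of_rat q) \<theta> \<noteq> 0}"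

definition int_ring_gen :: "complex \<Rightarrow> complex set" where
  "int_ring_gen \<theta> = {poly (map_poly of_int p) \<theta> | p. True}"

definition ring_of_integers :: "complex set \<Rightarrow> complex set" where
  "ring_of_integers K = {x \<in> K. algebraic_int x}"

end

theory Submission
  imports Defs "Jordan_Normal_Form.Char_Poly"
begin

text \<open>
  Write \<open>g\<close> for the quintic. If an element \<open>f(\<theta>)/p\<close> outside \<open>\<int>[\<theta>]\<close> is integral over
  \<open>\<int>[\<theta>]\<close>, let \<open>h\<close> generate the ideal \<open>(p, g, f)\<close> modulo \<open>p\<close> and write \<open>g = h k + p t\<close>. Then \<open>k\<close> is not a
  unit modulo \<open>p\<close>, and clearing denominators in monic equations for \<open>h(\<theta>)/p = - t(\<theta>)/k(\<theta>)\<close> puts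
  \<open>h\<close> and \<open>t\<close> into every prime ideal \<open>M\<close> of \<open>\<int>[x]\<close> containing \<open>p\<close> and \<open>k\<close>. So \<open>g \<in> M\<^sup>2\<close>, and in
  particular \<open>g' = x\<^sup>3 (5x + 4c) \<in> M\<close>. This forces \<open>M = (p, x - x\<^sub>0)\<close> with
  \<open>p\<^sup>2\<close> dividing \<open>g(x\<^sub>0)\<close>, where \<open>x\<^sub>0\<close> is \<open>0\<close>, or \<open>- d\<close> for \<open>p = 5\<close>, or \<open>- 4c/5\<close> modulo \<open>p\<^sup>2\<close>; the last case
  is excluded by the square-freeness hypothesis because \<open>5\<^sup>5 g(- 4c/5) = 5\<^sup>5 d + 2\<^sup>8 c\<^sup>5\<close>. Conversely,
  if \<open>p\<^sup>2\<close> divides \<open>g(x\<^sub>0)\<close> and \<open>p\<close> divides \<open>g'(x\<^sub>0)\<close>, then \<open>g(x\<^sub>0) / (p (\<theta> - x\<^sub>0))\<close> is an algebraic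
  integer outside \<open>\<int>[\<theta>]\<close>.
\<close>

section \<open>Ideals of integer polynomials containing a prime\<close>

definition is_ideal :: "'a::comm_ring_1 set \<Rightarrow> bool" where
  "is_ideal J \<longleftrightarrow> 0 \<in> J \<and> (\<forall>a\<in>J. \<forall>b\<in>J. a + b \<in> J) \<and> (\<forall>a\<in>J. \<forall>r. r * a \<in> J)"

definition is_prime_ideal :: "'a::comm_ring_1 set \<Rightarrow> bool" where
  "is_prime_ideal M \<longleftrightarrow> is_ideal M \<and> 1 \<notin> M \<and> (\<forall>a b. a * b \<in> M \<longrightarrow> a \<in> M \<or> b \<in> M)"

definition gen2 :: "'a::comm_ring_1 \<Rightarrow> 'a \<Rightarrow> 'a set" where
  "gen2 a b = {u * a + v * b | u v. True}"

lemma is_idealD: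
  assumes "is_ideal J"
  shows "0 \<in> J" "a \<in> J \<Longrightarrow> b \<in> J \<Longrightarrow> a + b \<in> J" "a \<in> J \<Longrightarrow> r * a \<in> J" "a \<in> J \<Longrightarrow> a * r \<in> J"
  using assms by (auto simp: is_ideal_def mult.commute)

lemma is_ideal_diff:
  assumes "is_ideal J" "a \<in> J" "b \<in> J"
  shows "a - b \<in> J"
  using is_idealD(2)[OF assms(1,2) is_idealD(3)[OF assms(1,3), of "-1"]] by simp

lemma is_ideal_sum:
  assumes "is_ideal J" "\<And>i. i \<in> I \<Longrightarrow> f i \<in> J"
  shows "sum f I \<in> J"
  using assms(2)
  by (induction I rule: infinite_finite_induct) (auto intro: is_idealD[OF assms(1)])

lemma is_prime_ideal_power:
  assumes "is_prime_ideal M" "a ^ n \<in> M"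
  shows "a \<in> M"
  using assms(2) by (induction n) (use assms(1) in \<open>auto simp: is_prime_ideal_def\<close>)

lemma is_ideal_gen2: "is_ideal (gen2 a b)"
proof -
  have "\<exists>u v. 0 = u * a + v * b"
    by (rule exI[of _ 0], rule exI[of _ 0]) simp
  moreover have "\<exists>u v. (u1 * a + v1 * b) + (u2 * a + v2 * b) = u * a + v * b" for u1 v1 u2 v2
    by (rule exI[of _ "u1 + u2"], rule exI[of _ "v1 + v2"]) (simp add: algebra_simps)
  moreover have "\<exists>u v. r * (u1 * a + v1 * b) = u * a + v * b" for r u1 v1
    by (rule exI[of _ "r * u1"], rule exI[of _ "r * v1"]) (simp add: algebra_simps)
  ultimately show ?thesis
    unfolding is_ideal_def gen2_def by blast
qed

lemma gen2_left: "a \<in> gen2 a b" and gen2_right: "b \<in> gen2 a b"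
proof -
  have "a = 1 * a + 0 * b" "b = 0 * a + 1 * b" by simp_all
  then show "a \<in> gen2 a b" "b \<in> gen2 a b" unfolding gen2_def by blast+
qed

lemma is_ideal_adjoin:
  assumes "is_ideal J"
  shows "is_ideal {u + r * a | u r. u \<in> J}"
proof -
  have "\<exists>u r. 0 = u + r * a \<and> u \<in> J"
    by (rule exI[of _ 0], rule exI[of _ 0]) (simp add: is_idealD[OF assms])
  moreover have "\<exists>u r. (u1 + r1 * a) + (u2 + r2 * a) = u + r * a \<and> u \<in> J"
    if "u1 \<in> J" "u2 \<in> J" for u1 r1 u2 r2
    by (rule exI[of _ "u1 + u2"], rule exI[of _ "r1 + r2"])
      (simp add: algebra_simps is_idealD[OF assms] that)
  moreover have "\<exists>u r. s * (u1 + r1 * a) = u + r * a \<and> u \<in> J" if "u1 \<in> J" for s u1 r1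
    by (rule exI[of _ "s * u1"], rule exI[of _ "s * r1"])
      (simp add: algebra_simps is_idealD[OF assms] that)
  ultimately show ?thesis
    unfolding is_ideal_def by blast
qed

lemma subset_adjoin: "(J :: 'a::comm_ring_1 set) \<subseteq> {u + r * a | u r. u \<in> J}"
proof
  fix x assume "x \<in> J"
  moreover have "x = x + 0 * a" by simp
  ultimately show "x \<in> {u + r * a | u r. u \<in> J}" by blast
qed

lemma mem_adjoin:
  assumes "is_ideal J"
  shows "a \<in> {u + r * a | u r. u \<in> J}"
proof -
  have "a = 0 + 1 * a" by simp
  then show ?thesis using is_idealD(1)[OF assms] by blast
qed

text \<open>Since \<open>p\<close> lies in \<open>J\<close>, the image of \<open>J\<close> in
  \<open>F_p[x]\<close> is principal, generated by the monic member of least degree. Stating this as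
  containment in every ideal that holds \<open>p\<close> and \<open>m\<close> avoids the quotient
  ring.\<close>

lemma ideal_mod_prime_principal:
  fixes p :: int and m :: "int poly"
  assumes "prime p"
    and J: "is_ideal J" "[:p:] \<in> J"
    and m: "lead_coeff m = 1" "\<And>h. h \<in> J \<Longrightarrow> lead_coeff h = 1 \<Longrightarrow> degree m \<le> degree h"
    and mJ: "m \<in> J"
    and M: "is_ideal M" "[:p:] \<in> M" "m \<in> M"
  shows "J \<subseteq> M"
proof
  \<comment> \<open>Bounding the exponents strictly by \<open>n\<close>, instead of the degree by
    \<open>n\<close>, lets the induction end at the zero polynomial.\<close>
  have main: "f \<in> M" if "f \<in> J" "\<forall>i\<ge>n. coeff f i = 0" for f n
    using that
  proof (induction n arbitrary: f)
    case 0
    then have "f = 0" by (simp add: poly_eq_iff)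
    then show ?case using is_idealD(1)[OF M(1)] by simp
  next
    case (Suc n)
    define a where "a = coeff f n"
    show ?case
    proof (cases "p dvd a")
      case True
      then obtain b where b: "a = p * b" by auto
      have eq: "monom a n = monom b n * [:p:]"
        by (simp add: b smult_monom)
      have "f - monom a n \<in> J"
        unfolding eq by (intro is_ideal_diff J Suc.prems is_idealD(3))
      moreover have "\<forall>i\<ge>n. coeff (f - monom a n) i = 0"
        using Suc.prems by (auto simp: a_def coeff_monom)
      ultimately have "f - monom a n \<in> M" by (rule Suc.IH)
      then have "f - monom a n + monom a n \<in> M"
        unfolding eq by (intro is_idealD(2,3) M)
      then show ?thesis by simp
    next
      case False
      with \<open>prime p\<close> have "Rings.coprime a p"
        by (metis prime_imp_coprime Rings.coprime_commute)
      then obtain e q where eq: "e * a + q * p = 1"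
        by (metis bezout_int coprime_iff_gcd_eq_1)
      \<comment> \<open>The coefficient at \<open>x^n\<close> is \<open>e a + q p = 1\<close>, so
        \<open>h\<close> is a monic element of \<open>J\<close> of degree \<open>n\<close>, and
        minimality bounds \<open>degree m\<close> by \<open>n\<close>.\<close>
      define h where "h = Polynomial.smult e f + monom q n * [:p:]"
      have hJ: "h \<in> J"
        unfolding h_def
        using is_idealD(2)[OF J(1) is_idealD(3)[OF J(1) Suc.prems(1), of "[:e:]"]
            is_idealD(3)[OF J, of "monom q n"]]
        by simp
      have hn: "coeff h n = 1"
        using eq by (simp add: h_def a_def mult.commute)
      have hi: "coeff h i = 0" if "i > n" for i
        using that Suc.prems by (simp add: h_def coeff_monom)
      have "degree h = n"
        using hn hi by (intro antisym degree_le le_degree) auto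
      then have dm: "degree m \<le> n" using m(2)[OF hJ] hn by simp
      define r where "r = monom a (n - degree m) * m"
      have "f - r \<in> J"
        unfolding r_def by (intro is_ideal_diff J Suc.prems is_idealD(3) mJ)
      moreover have "\<forall>i\<ge>n. coeff (f - r) i = 0"
      proof (intro allI impI)
        fix i assume "i \<ge> n"
        show "coeff (f - r) i = 0"
        proof (cases "i = n")
          case True
          then show ?thesis using dm m(1)
            by (simp add: r_def coeff_monom_mult a_def)
        next
          case False
          with \<open>i \<ge> n\<close> have "i - (n - degree m) > degree m" using dm by linarith
          then have "coeff r i = 0"
            by (simp add: r_def coeff_monom_mult coeff_eq_0)
          moreover have "coeff f i = 0" using False \<open>i \<ge> n\<close> Suc.prems by simp
          ultimately show ?thesis by simp
        qed
      qed
      ultimately have "f - r \<in> M" by (rule Suc.IH)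
      then have "f - r + r \<in> M"
        unfolding r_def by (intro is_idealD(2,3) M)
      then show ?thesis by simp
    qed
  qed
  fix f assume "f \<in> J"
  then show "f \<in> M"
    using main[of f "Suc (degree f)"] by (simp add: coeff_eq_0)
qed

text \<open>Minimal degree replaces Zorn's lemma. Among all monic members of proper ideals above
  \<open>J\<close>, \<open>m\<close> has least degree, so it is still minimal in any proper ideal
  \<open>N\<close> above \<open>M\<close>, and \<open>N \<subseteq> M\<close> by the preceding
  lemma. Thus \<open>M\<close> is maximal, hence prime.\<close>

lemma prime_ideal_over_prime:
  fixes p :: int and g :: "int poly"
  assumes "prime p"
    and J: "is_ideal J" "[:p:] \<in> J" "1 \<notin> J"
    and g: "g \<in> J" "lead_coeff g = 1"
  obtains M where "is_prime_ideal M" "J \<subseteq> M"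
proof -
  define Q where
    "Q m \<longleftrightarrow> lead_coeff m = 1 \<and> (\<exists>M. is_ideal M \<and> J \<subseteq> M \<and> 1 \<notin> M \<and> m \<in> M)" for m :: "int poly"
  have "Q g" using J g by (auto simp: Q_def)
  then obtain m where "Q m" and min: "\<And>h. Q h \<Longrightarrow> degree m \<le> degree h"
    using ex_has_least_nat[of Q g degree] by blast
  then obtain M where m: "lead_coeff m = 1" and M: "is_ideal M" "J \<subseteq> M" "1 \<notin> M" "m \<in> M"
    by (auto simp: Q_def)
  have "b \<in> M" if ab: "a * b \<in> M" and a: "a \<notin> M" for a b
  proof -
    define N where "N = {u + r * a | u r. u \<in> M}"
    have N: "is_ideal N" "M \<subseteq> N" "a \<in> N"
      unfolding N_def by (rule is_ideal_adjoin[OF M(1)] subset_adjoin mem_adjoin[OF M(1)])+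
    have "1 \<in> N"
    proof (rule ccontr)
      assume "1 \<notin> N"
      then have "degree m \<le> degree h" if "h \<in> N" "lead_coeff h = 1" for h
        using that N M by (intro min) (auto simp: Q_def)
      then have "N \<subseteq> M"
        using N M J by (intro ideal_mod_prime_principal[OF \<open>prime p\<close> N(1) _ m]) auto
      then show False using N(3) a by auto
    qed
    then obtain u r where u: "u \<in> M" "1 = u + r * a" by (auto simp: N_def)
    have "b = b * u + r * (a * b)"
      using arg_cong[OF u(2), of "\<lambda>x. b * x"] by (simp add: algebra_simps)
    also have "\<dots> \<in> M" by (intro is_idealD(2,3) M u ab)
    finally show ?thesis .
  qed
  then have "is_prime_ideal M" using M by (auto simp: is_prime_ideal_def)
  then show ?thesis using that M by blast
qed

section \<open>Bezout identities with an irreducible polynomial\<close>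

text \<open>Pseudo-division by a nonzero \<open>q\<close> of least degree in \<open>(f, g)\<close>
  shows that \<open>q\<close> divides nonzero integer multiples of \<open>f\<close> and
  \<open>g\<close>. As \<open>g\<close> is prime and does not divide \<open>q\<close>, it divides
  the cofactor \<open>s\<close> in \<open>a g = q s\<close>, so \<open>q\<close> divides the
  constant \<open>a\<close>.\<close>

lemma irreducible_bezout:
  fixes f g :: "int poly"
  assumes irr: "irreducible g" and "degree g > 0" and ndvd: "\<not> g dvd f"
  obtains u v and N :: int where "N \<noteq> 0" "u * f + v * g = [:N:]"
proof -
  have g: "prime_elem g" using irr by (rule irreducible_imp_prime_elem)
  have gC: "\<not> g dvd [:a:]" if "a \<noteq> 0" for a
    using dvd_imp_degree_le[of g "[:a:]"] that \<open>degree g > 0\<close> by auto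
  define Q where "Q q \<longleftrightarrow> q \<in> gen2 f g \<and> q \<noteq> 0" for q
  have "Q g" using irr by (auto simp: Q_def gen2_right)
  then obtain q where "Q q" and min: "\<And>h. Q h \<Longrightarrow> degree q \<le> degree h"
    using ex_has_least_nat[of Q g degree] by blast
  then have q: "q \<in> gen2 f g" "q \<noteq> 0" by (auto simp: Q_def)
  have dv: "\<exists>a s. a \<noteq> 0 \<and> [:a:] * h = q * s" if h: "h \<in> gen2 f g" for h
  proof -
    obtain a s where as: "a \<noteq> 0" "Polynomial.smult a h = q * s + pseudo_mod h q"
      using pseudo_mod(1)[OF q(2), of h] by blast
    have "pseudo_mod h q = [:a:] * h - s * q" using as by (simp add: mult.commute)
    also have "\<dots> \<in> gen2 f g"
      by (intro is_ideal_diff is_idealD(3) is_ideal_gen2 h q)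
    finally have "pseudo_mod h q = 0"
      using min[of "pseudo_mod h q"] pseudo_mod(2)[OF q(2), of h] by (fastforce simp: Q_def)
    then show ?thesis using as by auto
  qed
  obtain a s where as: "a \<noteq> 0" "[:a:] * g = q * s" using dv gen2_right by blast
  obtain b r where br: "b \<noteq> 0" "[:b:] * f = q * r" using dv gen2_left by blast
  have "\<not> g dvd q"
  proof
    assume "g dvd q"
    then have "g dvd [:b:] * f" using br by simp
    then show False using g gC[OF br(1)] ndvd prime_elem_dvd_mult_iff by blast
  qed
  moreover have "g dvd q * s" using as(2) by (metis dvd_triv_right)
  ultimately have "g dvd s" using g prime_elem_dvd_mult_iff by blast
  then obtain w where "s = g * w" by auto
  then have "g * (q * w) = g * [:a:]" using as(2) by (simp add: mult_ac)
  then have "q * w = [:a:]" using irr by (metis mult_left_cancel not_irreducible_zero)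
  then have "[:a:] = w * q" by (simp add: mult.commute)
  also have "\<dots> \<in> gen2 f g" by (intro is_idealD(3) is_ideal_gen2 q)
  finally show ?thesis using that as(1) by (auto simp: gen2_def)
qed

section \<open>Integrality over the order generated by an algebraic integer\<close>

abbreviation ieval :: "complex \<Rightarrow> int poly \<Rightarrow> complex" where
  "ieval \<theta> f \<equiv> poly (map_poly of_int f) \<theta>"

definition integral_over :: "complex set \<Rightarrow> complex \<Rightarrow> bool" where
  "integral_over R x \<longleftrightarrow> (\<exists>P. lead_coeff P = 1 \<and> (\<forall>i. coeff P i \<in> R) \<and> poly P x = 0)"

lemma ieval_in_int_ring_gen: "ieval \<theta> f \<in> int_ring_gen \<theta>"
  by (auto simp: int_ring_gen_def)

lemma ieval_add: "ieval \<theta> (f + g) = ieval \<theta> f + ieval \<theta> g"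
  and ieval_diff: "ieval \<theta> (f - g) = ieval \<theta> f - ieval \<theta> g"
  and ieval_minus: "ieval \<theta> (- f) = - ieval \<theta> f"
  and ieval_mult: "ieval \<theta> (f * g) = ieval \<theta> f * ieval \<theta> g"
  and ieval_power: "ieval \<theta> (f ^ n) = ieval \<theta> f ^ n"
  and ieval_const: "ieval \<theta> [:a:] = of_int a"
  and ieval_sum: "ieval \<theta> (sum F I) = (\<Sum>i\<in>I. ieval \<theta> (F i))"
  by (simp_all add: of_int_poly_hom.hom_add of_int_poly_hom.hom_mult of_int_poly_hom.hom_minus
      of_int_poly_hom.hom_uminus of_int_poly_hom.hom_power of_int_poly_hom.hom_sum poly_sum of_int_hom.map_poly_pCons_hom)

lemmas ieval_simps = ieval_add ieval_diff ieval_minus ieval_mult ieval_power ieval_const ieval_sum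

lemma int_ring_gen_closed:
  shows int_ring_gen_of_int: "of_int a \<in> int_ring_gen \<theta>"
    and int_ring_gen_add: "x \<in> int_ring_gen \<theta> \<Longrightarrow> y \<in> int_ring_gen \<theta> \<Longrightarrow> x + y \<in> int_ring_gen \<theta>"
    and int_ring_gen_uminus: "x \<in> int_ring_gen \<theta> \<Longrightarrow> - x \<in> int_ring_gen \<theta>"
    and int_ring_gen_mult: "x \<in> int_ring_gen \<theta> \<Longrightarrow> y \<in> int_ring_gen \<theta> \<Longrightarrow> x * y \<in> int_ring_gen \<theta>"
    and int_ring_gen_power: "x \<in> int_ring_gen \<theta> \<Longrightarrow> x ^ n \<in> int_ring_gen \<theta>"
  unfolding int_ring_gen_def by (auto simp: ieval_simps[symmetric] simp del: ieval_const)
    (metis ieval_const)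

lemma int_ring_gen_sum:
  assumes "\<And>i. i \<in> I \<Longrightarrow> F i \<in> int_ring_gen \<theta>"
  shows "sum F I \<in> int_ring_gen \<theta>"
  using assms int_ring_gen_of_int[of 0 \<theta>]
  by (induction I rule: infinite_finite_induct) (auto intro: int_ring_gen_add)

lemma algebraic_int_imp_integral_over:
  assumes "algebraic_int x"
  shows "integral_over (int_ring_gen \<theta>) x"
  using assms unfolding algebraic_int.simps integral_over_def
  by (metis Ints_cases int_ring_gen_of_int)

text \<open>If \<open>P\<close> is the monic equation of \<open>x\<close>, of degree
  \<open>n\<close>, then \<open>a + c x\<close> is a root of \<open>c^n P((Y - a)/c)\<close>, which
  expands to a monic polynomial in \<open>Y\<close> without denominators. Working over
  \<open>Z[\<theta>]\<close> makes this elementary closure property sufficient.\<close>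

lemma integral_over_affine:
  assumes x: "integral_over (int_ring_gen \<theta>) x"
    and a: "a \<in> int_ring_gen \<theta>" and c: "c \<in> int_ring_gen \<theta>"
  shows "integral_over (int_ring_gen \<theta>) (a + c * x)"
proof -
  let ?R = "int_ring_gen \<theta>"
  obtain P where P: "lead_coeff P = 1" "\<And>i. coeff P i \<in> ?R" "poly P x = 0"
    using x by (auto simp: integral_over_def)
  define n where "n = degree P"
  have n: "n > 0"
  proof (rule ccontr)
    assume "\<not> n > 0"
    then obtain u where "P = [:u:]" by (auto simp: n_def elim: degree_eq_zeroE)
    then show False using P by simp
  qed
  have P0: "x ^ n + (\<Sum>i<n. coeff P i * x ^ i) = 0"
    using P by (simp add: poly_altdef n_def lessThan_Suc_atMost[symmetric] add.commute)
  define l where "l = [:- a, 1:]"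
  define S where "S = (\<Sum>i<n. Polynomial.smult (coeff P i * c ^ (n - i)) (l ^ i))"
  have pow: "coeff (l ^ i) j \<in> ?R" for i j
  proof (induction i arbitrary: j)
    case 0
    show ?case using int_ring_gen_of_int[of 1 \<theta>] int_ring_gen_of_int[of 0 \<theta>]
      by (auto simp: coeff_1)
  next
    case (Suc i)
    have "coeff l k \<in> ?R" for k
      using int_ring_gen_of_int[of 1 \<theta>] int_ring_gen_of_int[of 0 \<theta>] a
      by (auto simp: l_def coeff_pCons int_ring_gen_uminus split: nat.splits)
    then show ?case
      by (auto simp: coeff_mult intro!: int_ring_gen_sum int_ring_gen_mult Suc.IH)
  qed
  have "degree S < n"
    unfolding S_def
    using n by (intro degree_sum_less) (auto simp: l_def degree_linear_power intro: le_less_trans[OF degree_smult_le])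
  then have "lead_coeff (S + l ^ n) = 1"
    by (subst lead_coeff_add_le) (auto simp: l_def degree_linear_power coeff_linear_power)
  moreover have "coeff (S + l ^ n) j \<in> ?R" for j
    by (auto simp: S_def coeff_sum
        intro!: int_ring_gen_add pow int_ring_gen_sum int_ring_gen_mult P int_ring_gen_power c)
  moreover have "poly (S + l ^ n) (a + c * x) = 0"
  proof -
    have "poly (S + l ^ n) (a + c * x) = (\<Sum>i<n. coeff P i * c ^ (n - i) * (c * x) ^ i) + (c * x) ^ n"
      by (simp add: S_def l_def poly_sum poly_power)
    also have "(\<Sum>i<n. coeff P i * c ^ (n - i) * (c * x) ^ i) = (\<Sum>i<n. c ^ n * (coeff P i * x ^ i))"
    proof (intro sum.cong refl)
      fix i assume "i \<in> {..<n}"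
      then have "c ^ n = c ^ (n - i) * c ^ i" by (simp add: power_add[symmetric])
      then show "coeff P i * c ^ (n - i) * (c * x) ^ i = c ^ n * (coeff P i * x ^ i)"
        by (simp add: power_mult_distrib)
    qed
    also have "\<dots> + (c * x) ^ n = c ^ n * (x ^ n + (\<Sum>i<n. coeff P i * x ^ i))"
      by (simp add: sum_distrib_left power_mult_distrib algebra_simps)
    finally show ?thesis by (simp add: P0)
  qed
  ultimately show ?thesis unfolding integral_over_def by blast
qed

text \<open>Clearing denominators in a monic equation for \<open>x/y\<close> shows that \<open>x\<close> lies in every prime
  containing \<open>y\<close>.\<close>

lemma integral_ratio_in_prime_ideal:
  assumes \<beta>: "integral_over (int_ring_gen \<theta>) \<beta>"
    and xy: "ieval \<theta> x = \<beta> * ieval \<theta> y"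
    and M: "is_prime_ideal M" and ker: "\<And>f. ieval \<theta> f = 0 \<Longrightarrow> f \<in> M"
    and y: "y \<in> M"
  shows "x \<in> M"
proof -
  obtain P where P: "lead_coeff P = 1" "\<And>i. coeff P i \<in> int_ring_gen \<theta>" "poly P \<beta> = 0"
    using \<beta> by (auto simp: integral_over_def)
  have "\<forall>i. \<exists>f. coeff P i = ieval \<theta> f"
    using P(2) by (auto simp: int_ring_gen_def)
  then obtain b where b: "\<And>i. coeff P i = ieval \<theta> (b i)" by metis
  define n where "n = degree P"
  have P0: "\<beta> ^ n + (\<Sum>i<n. coeff P i * \<beta> ^ i) = 0"
    using P by (simp add: poly_altdef n_def lessThan_Suc_atMost[symmetric] add.commute)
  \<comment> \<open>\<open>x ^ n + S\<close> lifts \<open>y(\<theta>)^n P(\<beta>) = 0\<close> to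
    \<open>Z[x]\<close>, and every term of \<open>S\<close> keeps a factor \<open>y\<close> because
    \<open>i < n\<close>.\<close>
  define S where "S = (\<Sum>i<n. b i * x ^ i * y ^ (n - i))"
  have id: "is_ideal M" using M by (simp add: is_prime_ideal_def)
  have "ieval \<theta> (x ^ n + S) = ieval \<theta> x ^ n + (\<Sum>i<n. coeff P i * ieval \<theta> x ^ i * ieval \<theta> y ^ (n - i))"
    by (simp add: S_def ieval_simps b)
  also have "(\<Sum>i<n. coeff P i * ieval \<theta> x ^ i * ieval \<theta> y ^ (n - i)) =
      (\<Sum>i<n. ieval \<theta> y ^ n * (coeff P i * \<beta> ^ i))"
  proof (intro sum.cong refl)
    fix i assume "i \<in> {..<n}"
    then have "ieval \<theta> y ^ n = ieval \<theta> y ^ i * ieval \<theta> y ^ (n - i)"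
      by (simp add: power_add[symmetric])
    then show "coeff P i * ieval \<theta> x ^ i * ieval \<theta> y ^ (n - i) =
        ieval \<theta> y ^ n * (coeff P i * \<beta> ^ i)"
      by (simp add: xy power_mult_distrib)
  qed
  also have "ieval \<theta> x ^ n + \<dots> = ieval \<theta> y ^ n * (\<beta> ^ n + (\<Sum>i<n. coeff P i * \<beta> ^ i))"
    by (simp add: xy sum_distrib_left power_mult_distrib algebra_simps)
  finally have "x ^ n + S \<in> M" using P0 by (intro ker) simp
  moreover have "S \<in> M"
    unfolding S_def
  proof (rule is_ideal_sum[OF id])
    fix i assume "i \<in> {..<n}"
    then have "n - i = Suc (n - i - 1)" by simp
    then have "b i * x ^ i * y ^ (n - i) = b i * x ^ i * y ^ (n - i - 1) * y"
      by (metis mult.assoc power_Suc2)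
    then show "b i * x ^ i * y ^ (n - i) \<in> M"
      using is_idealD(3)[OF id y] by metis
  qed
  ultimately have "x ^ n + S - S \<in> M" by (rule is_ideal_diff[OF id])
  then have "x ^ n \<in> M" by simp
  then show ?thesis by (rule is_prime_ideal_power[OF M])
qed

text \<open>The conclusion amounts to \<open>f(\<theta>)/p\<close> lying in
  \<open>Z[\<theta>]\<close>. Hypothesis \<open>reg\<close> forbids a decomposition of
  \<open>g\<close> that witnesses \<open>g \<in> M^2\<close> for a prime \<open>M\<close> over
  \<open>p\<close>.\<close>

lemma p_maximal_at_regular_prime:
  fixes p :: int and f g :: "int poly"
  assumes p: "prime p" and g: "lead_coeff g = 1" "ieval \<theta> g = 0"
    and ker: "\<And>q. ieval \<theta> q = 0 \<Longrightarrow> g dvd q"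
    and int: "integral_over (int_ring_gen \<theta>) (ieval \<theta> f / of_int p)"
    and reg: "\<And>M h k t. is_prime_ideal M \<Longrightarrow> [:p:] \<in> M \<Longrightarrow> h \<in> M \<Longrightarrow> k \<in> M \<Longrightarrow> t \<in> M \<Longrightarrow>
                g = h * k + [:p:] * t \<Longrightarrow> False"
  shows "f \<in> gen2 [:p:] g"
proof -
  have p0: "p \<noteq> 0" using p by auto
  define I where "I = gen2 [:p:] g"
  define J where "J = {u + r * f | u r. u \<in> I}"
  have I: "is_ideal I" "[:p:] \<in> I" "g \<in> I"
    unfolding I_def by (rule is_ideal_gen2 gen2_left gen2_right)+
  have J: "is_ideal J" "I \<subseteq> J" "f \<in> J"
    unfolding J_def by (rule is_ideal_adjoin[OF I(1)] subset_adjoin mem_adjoin[OF I(1)])+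
  define Q where "Q h \<longleftrightarrow> h \<in> J \<and> lead_coeff h = 1" for h
  have "Q g" using g I J by (auto simp: Q_def)
  \<comment> \<open>\<open>m\<close> is a monic gcd of \<open>f\<close> and \<open>g\<close> modulo
    \<open>p\<close>.\<close>
  then obtain m where "Q m" and min: "\<And>h. Q h \<Longrightarrow> degree m \<le> degree h"
    using ex_has_least_nat[of Q g degree] by blast
  then have m: "lead_coeff m = 1" "m \<in> J" by (auto simp: Q_def)
  have sub: "J \<subseteq> N" if "is_ideal N" "[:p:] \<in> N" "m \<in> N" for N
    using ideal_mod_prime_principal[OF p J(1) _ m(1) _ m(2) that] I J min by (auto simp: Q_def)
  have "g \<in> gen2 [:p:] m"
    using sub[OF is_ideal_gen2 gen2_left gen2_right] I J by blast
  then obtain t k where "g = t * [:p:] + k * m" by (auto simp: gen2_def)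
  then have gk: "g = m * k + [:p:] * t" by (simp only: mult_ac add_ac)
  define K where "K = gen2 [:p:] k"
  have K: "is_ideal K" "[:p:] \<in> K" "k \<in> K"
    unfolding K_def by (rule is_ideal_gen2 gen2_left gen2_right)+
  show ?thesis
  proof (cases "1 \<in> K")
    \<comment> \<open>Here \<open>k\<close> is a unit modulo \<open>p\<close>, so \<open>m\<close>,
      and with it all of \<open>J\<close>, already lies in \<open>(p, g)\<close>.\<close>
    case True
    then obtain u v where uv: "1 = u * [:p:] + v * k" by (auto simp: K_def gen2_def)
    have "m = (u * m - v * t) * [:p:] + v * g"
      using arg_cong[OF uv, of "\<lambda>x. m * x"] unfolding gk by (simp add: algebra_simps)
    also have "\<dots> \<in> I" by (intro is_idealD(2,3) I)
    finally have "m \<in> I" .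
    then show ?thesis using sub[OF I(1,2)] J by (auto simp: I_def)
  next
    case False
    have gK: "g \<in> K" unfolding gk by (intro is_idealD K)
    obtain M where M: "is_prime_ideal M" "K \<subseteq> M"
      using prime_ideal_over_prime[OF p K(1,2) False gK g(1)] .
    have id: "is_ideal M" using M by (simp add: is_prime_ideal_def)
    have kerM: "q \<in> M" if "ieval \<theta> q = 0" for q
      using ker[OF that] gK M(2) is_idealD(4)[OF id] by (auto elim!: dvdE)
    obtain a b r where "m = (a * [:p:] + b * g) + r * f"
      using m(2) by (auto simp: J_def I_def gen2_def)
    then have "ieval \<theta> m = ieval \<theta> a * of_int p + ieval \<theta> r * ieval \<theta> f"
      by (simp only: ieval_simps g) simp
    then have eq: "ieval \<theta> m / of_int p = ieval \<theta> a + ieval \<theta> r * (ieval \<theta> f / of_int p)"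
      using p0 by (simp add: field_simps)
    have int': "integral_over (int_ring_gen \<theta>) (ieval \<theta> m / of_int p)"
      unfolding eq by (intro integral_over_affine int ieval_in_int_ring_gen)
    \<comment> \<open>The same integral number is written as \<open>m(\<theta>)/p\<close> and as
      \<open>-t(\<theta>)/k(\<theta>)\<close>; both denominators lie in \<open>M\<close>, so both
      numerators do.\<close>
    have "m \<in> M"
      by (rule integral_ratio_in_prime_ideal[OF int' _ M(1) kerM, of _ "[:p:]"])
        (use p0 K M in \<open>auto simp: ieval_const\<close>)
    moreover have "- t \<in> M"
    proof (rule integral_ratio_in_prime_ideal[OF int' _ M(1) kerM, of _ "k"])
      have "ieval \<theta> m * ieval \<theta> k + of_int p * ieval \<theta> t = 0"
        using g(2) unfolding gk ieval_simps .
      then show "ieval \<theta> (- t) = ieval \<theta> m / of_int p * ieval \<theta> k"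
        using p0 by (simp add: field_simps ieval_minus) (simp add: algebra_simps neg_eq_iff_add_eq_0)
    qed (use K M in auto)
    ultimately show ?thesis
      using reg[OF M(1) _ _ _ _ gk] K M is_idealD(3)[OF id, of "-t" "-1"] by auto
  qed
qed

section \<open>The kernel of evaluation and denominators in \<open>Q(\<theta>)\<close>\<close>

text \<open>Otherwise a nonzero integer would be a combination of \<open>f\<close> and
  \<open>g\<close>, which both vanish at \<theta>.\<close>

lemma ieval_kernel:
  assumes "irreducible g" "degree g > 0" "ieval \<theta> g = 0" "ieval \<theta> f = 0"
  shows "g dvd f"
proof (rule ccontr)
  assume "\<not> g dvd f"
  then obtain u v and N :: int where "N \<noteq> 0" and N: "u * f + v * g = [:N:]"
    using irreducible_bezout assms by blast
  have "of_int N = ieval \<theta> (u * f + v * g)" unfolding N ieval_const ..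
  also have "\<dots> = 0" using assms by (simp add: ieval_simps)
  finally show False using \<open>N \<noteq> 0\<close> by simp
qed

lemma rat_poly_clear_denominators:
  fixes \<theta> :: complex
  obtains n f where "n \<noteq> (0::int)" "of_int n * poly (map_poly of_rat p) \<theta> = ieval \<theta> f"
proof (induction p arbitrary: thesis)
  case 0
  show ?case by (rule 0[of 1 0]) simp_all
next
  case (pCons a p)
  obtain n f where nf: "n \<noteq> 0" "of_int n * poly (map_poly of_rat p) \<theta> = ieval \<theta> f"
    using pCons.IH .
  obtain b c where q: "quotient_of a = (b, c)" by fastforce
  have bc: "a = of_int b / of_int c" "c \<noteq> 0"
    using quotient_of_div[OF q] quotient_of_denom_pos[OF q] by simp_all
  have "of_int (n * c) * poly (map_poly of_rat (pCons a p)) \<theta> =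
      of_int (n * b) + of_int c * \<theta> * (of_int n * poly (map_poly of_rat p) \<theta>)"
    using bc by (simp add: of_rat_hom.map_poly_pCons_hom of_rat_divide algebra_simps)
  also have "\<dots> = ieval \<theta> (pCons (n * b) ([:c:] * f))"
    unfolding nf(2) of_int_hom.map_poly_pCons_hom poly_pCons ieval_mult ieval_const by simp
  finally show ?case using pCons.prems[of "n * c"] nf(1) bc(2) by simp
qed

text \<open>Evaluating the Bezout identity \<open>u Q + v g = N\<close> at \<theta> turns
  \<open>1/Q(\<theta>)\<close> into \<open>u(\<theta>)/N\<close>.\<close>

lemma rat_field_gen_common_denominator:
  assumes irr: "irreducible g" "degree g > 0" and root: "ieval \<theta> g = 0" and \<alpha>: "\<alpha> \<in> rat_field_gen \<theta>"
  obtains f and N :: int where "N > 0" "\<alpha> = ieval \<theta> f / of_int N"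
proof -
  obtain p q where pq: "\<alpha> = poly (map_poly of_rat p) \<theta> / poly (map_poly of_rat q) \<theta>"
      "poly (map_poly of_rat q) \<theta> \<noteq> 0"
    using \<alpha> by (auto simp: rat_field_gen_def)
  obtain n P where n: "n \<noteq> (0::int)" "of_int n * poly (map_poly of_rat p) \<theta> = ieval \<theta> P"
    by (rule rat_poly_clear_denominators)
  obtain m Q where m: "m \<noteq> (0::int)" "of_int m * poly (map_poly of_rat q) \<theta> = ieval \<theta> Q"
    by (rule rat_poly_clear_denominators)
  have Q0: "ieval \<theta> Q \<noteq> 0" unfolding m(2)[symmetric] using m(1) pq(2) by simp
  then have "\<not> g dvd Q" using root by (auto simp: ieval_simps elim!: dvdE)
  then obtain u v and N :: int where N: "N \<noteq> 0" "u * Q + v * g = [:N:]"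
    using irreducible_bezout irr by blast
  have "of_int N = ieval \<theta> (u * Q + v * g)" unfolding N ieval_const ..
  also have "\<dots> = ieval \<theta> u * ieval \<theta> Q" using root by (simp add: ieval_simps)
  finally have uQ: "of_int N = ieval \<theta> u * ieval \<theta> Q" .
  have pe: "poly (map_poly of_rat p) \<theta> = ieval \<theta> P / of_int n"
    and qe: "poly (map_poly of_rat q) \<theta> = ieval \<theta> Q / of_int m"
    unfolding n(2)[symmetric] m(2)[symmetric] using n(1) m(1) by simp_all
  have "ieval \<theta> u \<noteq> 0" using uQ N(1) by auto
  then have "\<alpha> = of_int m * ieval \<theta> u * ieval \<theta> P / of_int (n * N)"
    unfolding pq(1) pe qe using N(1) n(1) m(1) Q0 by (simp add: uQ)
  then have al: "\<alpha> = ieval \<theta> ([:m:] * u * P) / of_int (n * N)"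
    unfolding ieval_simps .
  show ?thesis
  proof (cases "n * N > 0")
    case True
    then show ?thesis using that al by blast
  next
    case False
    then have "- (n * N) > 0" using n N by (simp add: order_less_le)
    moreover have "\<alpha> = ieval \<theta> (- ([:m:] * u * P)) / of_int (- (n * N))"
      unfolding al ieval_minus by simp
    ultimately show ?thesis using that by blast
  qed
qed

text \<open>Prime factors are stripped from the denominator one at a time: for
  \<open>N = q K\<close>, the multiple \<open>f(\<theta>)/q\<close> is still integral, so
  \<open>f(\<theta>) = q u(\<theta>)\<close> and the element becomes
  \<open>u(\<theta>)/K\<close>.\<close>

lemma integral_in_int_ring_gen:
  fixes g :: "int poly"
  assumes irr: "irreducible g" "degree g > 0" and g: "lead_coeff g = 1" "ieval \<theta> g = 0"
    and reg: "\<And>(p::int) M h k t. prime p \<Longrightarrow> is_prime_ideal M \<Longrightarrow> [:p:] \<in> M \<Longrightarrow>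
                h \<in> M \<Longrightarrow> k \<in> M \<Longrightarrow> t \<in> M \<Longrightarrow> g = h * k + [:p:] * t \<Longrightarrow> False"
    and \<alpha>: "\<alpha> \<in> rat_field_gen \<theta>" "integral_over (int_ring_gen \<theta>) \<alpha>"
  shows "\<alpha> \<in> int_ring_gen \<theta>"
proof -
  have main: "ieval \<theta> f / of_int (int N) \<in> int_ring_gen \<theta>"
    if "N > 0" "integral_over (int_ring_gen \<theta>) (ieval \<theta> f / of_int (int N))" for f N
    using that
  proof (induction N arbitrary: f rule: less_induct)
    case (less N)
    show ?case
    proof (cases "N = 1")
      case True
      then show ?thesis by (simp add: ieval_in_int_ring_gen)
    next
      case False
      then obtain q where q: "prime q" "q dvd N" by (metis prime_factor_nat)
      then obtain K where K: "N = q * K" by auto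
      have K0: "K > 0" "q > 0" "K < N" using less.prems(1) K prime_gt_1_nat[OF q(1)] by auto
      have p: "prime (int q)" using q by simp
      have "ieval \<theta> f / of_int (int q) =
          of_int 0 + of_int (int K) * (ieval \<theta> f / of_int (int N))"
        using K0 by (simp add: K)
      then have "integral_over (int_ring_gen \<theta>) (ieval \<theta> f / of_int (int q))"
        using integral_over_affine[OF less.prems(2) int_ring_gen_of_int int_ring_gen_of_int] by metis
      then have "f \<in> gen2 [:int q:] g"
        using p_maximal_at_regular_prime[OF p g ieval_kernel[OF irr g(2)]] reg[OF p] by blast
      then obtain u v where "f = u * [:int q:] + v * g" by (auto simp: gen2_def)
      then have "ieval \<theta> f = ieval \<theta> u * of_int (int q)"
        by (simp only: ieval_simps g(2)) simp
      then have eq: "ieval \<theta> f / of_int (int N) = ieval \<theta> u / of_int (int K)"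
        using K0 by (simp add: K)
      show ?thesis
        using less.IH[of K u] less.prems K0 unfolding eq by blast
    qed
  qed
  obtain f N where N: "N > 0" "\<alpha> = ieval \<theta> f / of_int N"
    using rat_field_gen_common_denominator[OF irr g(2) \<alpha>(1)] .
  then have "\<alpha> = ieval \<theta> f / of_int (int (nat N))" by simp
  then show ?thesis using main[of "nat N" f] \<alpha>(2) N(1) by simp
qed

section \<open>Integrality of the elements of \<open>Z[\<theta>]\<close>\<close>

lemma monic_division:
  fixes f g :: "int poly"
  assumes "lead_coeff g = 1" "degree g > 0"
  obtains q r where "f = g * q + r" "degree r < degree g"
proof -
  have "g \<noteq> 0" using assms by auto
  obtain q r where "pseudo_divmod f g = (q, r)" by fastforce
  note pseudo_divmod[OF \<open>g \<noteq> 0\<close> this]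
  then show ?thesis using that[of q r] assms by auto
qed

text \<open>Row \<open>i\<close> of \<open>A\<close> holds the coefficients of \<open>f x^i\<close>
  reduced modulo \<open>g\<close>. The vector of powers of \<theta> is then an eigenvector with
  eigenvalue \<open>f(\<theta>)\<close>, which is thus a root of the monic integer polynomial
  \<open>char_poly A\<close>.\<close>

lemma algebraic_int_ieval:
  assumes g: "lead_coeff g = 1" "degree g > 0" "ieval \<theta> g = 0"
  shows "algebraic_int (ieval \<theta> f)"
proof -
  define n where "n = degree g"
  have "\<exists>r. ieval \<theta> (f * monom 1 i) = ieval \<theta> r \<and> degree r < n" for i
  proof -
    obtain q r where "f * monom 1 i = g * q + r" "degree r < degree g"
      using monic_division[OF g(1,2)] .
    then show ?thesis using g(3) by (intro exI[of _ r]) (simp add: ieval_simps n_def)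
  qed
  then obtain r where r: "\<And>i. ieval \<theta> (f * monom 1 i) = ieval \<theta> (r i)" "\<And>i. degree (r i) < n"
    by metis
  define A where "A = mat n n (\<lambda>(i, j). coeff (r i) j)"
  have A: "A \<in> carrier_mat n n" by (simp add: A_def)
  define B where "B = map_mat complex_of_int A"
  have B: "B \<in> carrier_mat n n" by (simp add: B_def A)
  define v where "v = vec n (\<lambda>i. \<theta> ^ i)"
  have "B *\<^sub>v v = ieval \<theta> f \<cdot>\<^sub>v v"
  proof (rule eq_vecI)
    fix i assume "i < dim_vec (ieval \<theta> f \<cdot>\<^sub>v v)"
    then have i: "i < n" by (simp add: v_def)
    have "(B *\<^sub>v v) $ i = (\<Sum>j<n. of_int (coeff (r i) j) * \<theta> ^ j)"
      using i by (simp add: B_def A_def v_def scalar_prod_def atLeast0LessThan)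
    also have "\<dots> = (\<Sum>j\<le>degree (r i). of_int (coeff (r i) j) * \<theta> ^ j)"
      using r(2)[of i] by (intro sum.mono_neutral_right) (auto simp: coeff_eq_0)
    also have "\<dots> = ieval \<theta> (r i)" by (simp add: poly_altdef)
    also have "\<dots> = ieval \<theta> f * \<theta> ^ i"
      unfolding r(1)[symmetric] ieval_mult by (simp add: poly_monom)
    finally show "(B *\<^sub>v v) $ i = (ieval \<theta> f \<cdot>\<^sub>v v) $ i" using i by (simp add: v_def)
  qed (simp add: v_def B_def A_def)
  \<comment> \<open>Entry 0 is \<open>\<theta> ^ 0 = 1\<close>, even for
    \<open>\<theta> = 0\<close>.\<close>
  moreover have "v \<noteq> 0\<^sub>v n"
  proof
    assume "v = 0\<^sub>v n"
    then have "v $ 0 = 0" using g(2) by (simp add: n_def)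
    then show False using g(2) by (simp add: v_def n_def)
  qed
  ultimately have "eigenvalue B (ieval \<theta> f)"
    unfolding eigenvalue_def eigenvector_def using B by (intro exI[of _ v]) (auto simp: v_def)
  then have "poly (char_poly B) (ieval \<theta> f) = 0"
    using eigenvalue_root_char_poly[OF B] by simp
  then have "ieval (ieval \<theta> f) (char_poly A) = 0"
    unfolding B_def of_int_hom.char_poly_hom[OF A] .
  moreover have "lead_coeff (char_poly A) = 1"
    using degree_monic_char_poly[OF A] by simp
  ultimately show ?thesis
    unfolding algebraic_int_altdef_ipoly by blast
qed

section \<open>Non-maximality at a double root\<close>

lemma ieval_monom: "ieval \<theta> (monom a i) = of_int a * \<theta> ^ i"
  by (simp add: poly_monom)

lemma ieval_pcompose_linear: "ieval \<theta> (pcompose f [:a, 1:]) = ieval (\<theta> + of_int a) f"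
  by (simp add: of_int_hom.map_poly_pcompose poly_pcompose of_int_hom.map_poly_pCons_hom add.commute)

lemma ieval_divide_in_rat_field_gen:
  assumes "N \<noteq> 0"
  shows "ieval \<theta> f / of_int N \<in> rat_field_gen \<theta>"
proof -
  have eq: "map_poly of_rat (map_poly of_int q) = (map_poly of_int q :: complex poly)" for q
    by (simp add: map_poly_map_poly o_def)
  have "ieval \<theta> f / of_int N = poly (map_poly of_rat (map_poly of_int f)) \<theta> /
      poly (map_poly of_rat (map_poly of_int [:N:])) \<theta>"
    unfolding eq ieval_const ..
  moreover have "poly (map_poly of_rat (map_poly of_int [:N:])) \<theta> \<noteq> 0"
    unfolding eq ieval_const using assms by simp
  ultimately show ?thesis unfolding rat_field_gen_def by blast
qed

text \<open>The monic integer polynomial \<open>T\<close> below is the reversed equation of \<open>y\<close>, rescaled so that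
  \<open>T(p m / y) y\<^bsup>N+2\<^esup> = p\<^bsup>N\<^esup> m\<^bsup>N+1\<^esup> (p\<^sup>2 m + p l y + y\<^sup>2 q(y))\<close>.\<close>

lemma algebraic_int_of_double_root:
  fixes q :: "int poly" and p m l :: int
  assumes q: "lead_coeff q = 1" and y: "y \<noteq> 0" "ieval y (pCons (p\<^sup>2 * m) (pCons (p * l) q)) = 0"
  shows "algebraic_int (of_int (p * m) / y)"
proof -
  define N where "N = degree q"
  define \<beta> where "\<beta> = of_int (p * m) / y"
  have \<beta>y: "\<beta> * y = of_int (p * m)" using y by (simp add: \<beta>_def)
  \<comment> \<open>The factor \<open>p^j m^(j+1)\<close> makes each term, once
    \<open>p m / y\<close> is inserted and \<open>y^(N+2)\<close> multiplied in, carry the common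
    factor \<open>p^N m^(N+1)\<close>.\<close>
  define S where "S = (\<Sum>j\<le>N. monom (coeff q j * p ^ j * m ^ Suc j) (N - j))"
  define T where "T = monom 1 (Suc (Suc N)) + monom l (Suc N) + S"
  have S0: "coeff S i = 0" if "i > N" for i
    using that by (auto simp: S_def coeff_sum intro!: sum.neutral)
  have "coeff T (Suc (Suc N)) = 1" by (simp add: T_def S0)
  moreover have "degree T = Suc (Suc N)"
    using calculation by (intro antisym degree_le le_degree) (auto simp: T_def S0)
  ultimately have T: "lead_coeff T = 1" by simp
  have "ieval \<beta> S * y ^ Suc (Suc N) =
      (\<Sum>j\<le>N. of_int (p ^ N * m ^ Suc N) * y\<^sup>2 * (of_int (coeff q j) * y ^ j))"
    unfolding S_def ieval_sum sum_distrib_right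
  proof (intro sum.cong refl)
    fix j assume "j \<in> {..N}"
    then obtain k where k: "N = k + j" by (metis atMost_iff le_add_diff_inverse2)
    have "ieval \<beta> (monom (coeff q j * p ^ j * m ^ Suc j) (N - j)) * y ^ Suc (Suc N) =
        of_int (coeff q j * p ^ j * m ^ Suc j) * (\<beta> * y) ^ k * y ^ j * y\<^sup>2"
      unfolding ieval_monom k by (simp add: power_add power_mult_distrib power2_eq_square)
    also have "\<dots> = of_int (p ^ N * m ^ Suc N) * y\<^sup>2 * (of_int (coeff q j) * y ^ j)"
      unfolding \<beta>y k by (simp add: power_add power_mult_distrib)
    finally show "ieval \<beta> (monom (coeff q j * p ^ j * m ^ Suc j) (N - j)) * y ^ Suc (Suc N) =
        of_int (p ^ N * m ^ Suc N) * y\<^sup>2 * (of_int (coeff q j) * y ^ j)" .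
  qed
  also have "\<dots> = of_int (p ^ N * m ^ Suc N) * (y\<^sup>2 * ieval y q)"
    by (simp add: sum_distrib_left[symmetric] poly_altdef N_def mult.assoc)
  finally have S: "ieval \<beta> S * y ^ Suc (Suc N) = of_int (p ^ N * m ^ Suc N) * (y\<^sup>2 * ieval y q)" .
  have "ieval \<beta> T * y ^ Suc (Suc N) =
      (\<beta> * y) ^ Suc (Suc N) + of_int l * (\<beta> * y) ^ Suc N * y + ieval \<beta> S * y ^ Suc (Suc N)"
    unfolding T_def ieval_add ieval_monom by (simp add: algebra_simps)
  also have "\<dots> = of_int (p ^ N * m ^ Suc N) *
      ieval y (pCons (p\<^sup>2 * m) (pCons (p * l) q))"
    unfolding S \<beta>y of_int_hom.map_poly_pCons_hom poly_pCons
    by (simp add: power_mult_distrib power2_eq_square algebra_simps)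
  finally have "ieval \<beta> T = 0" using y by simp
  then show ?thesis
    using T unfolding \<beta>_def algebraic_int_altdef_ipoly by blast
qed

text \<open>Around \<open>x0\<close>, \<open>g\<close> expands as \<open>p^2 m + Y w(Y)\<close> with
  \<open>w = p l + Y q\<close>. For \<open>y = \<theta> - x0\<close> this gives
  \<open>p m / y = -w(y)/p\<close>: the left side is an algebraic integer, while the right side is
  outside \<open>Z[\<theta>]\<close> because \<open>w\<close> is monic of degree below
  \<open>degree g\<close>.\<close>

lemma not_integrally_closed_at_double_root:
  fixes g :: "int poly" and p x0 :: int
  assumes irr: "irreducible g" "degree g \<ge> 2" and g: "lead_coeff g = 1" "ieval \<theta> g = 0"
    and p: "prime p" "p\<^sup>2 dvd poly g x0" "p dvd poly (pderiv g) x0"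
  shows "int_ring_gen \<theta> \<noteq> ring_of_integers (rat_field_gen \<theta>)"
proof -
  have dg: "degree g > 0" using irr by simp
  have p0: "p \<noteq> 0" using p by auto
  obtain m where m: "poly g x0 = p\<^sup>2 * m" using p by auto
  obtain l where l: "poly (pderiv g) x0 = p * l" using p by auto
  define h where "h = pcompose g [:x0, 1:]"
  have "lead_coeff h = lead_coeff g * lead_coeff [:x0, 1:] ^ degree g"
    unfolding h_def by (rule lead_coeff_comp) simp
  then have h: "lead_coeff h = 1" "degree h = degree g"
    using g by (simp_all add: h_def degree_pcompose)
  obtain a w where hw: "h = pCons a w" by (cases h)
  obtain b q where wq: "w = pCons b q" by (cases w)
  have "a = poly h 0" by (simp add: hw)
  also have "\<dots> = p\<^sup>2 * m" by (simp add: h_def poly_pcompose m)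
  finally have a: "a = p\<^sup>2 * m" .
  have "b = poly (pderiv h) 0" by (simp add: hw wq pderiv_pCons)
  also have "\<dots> = p * l" by (simp add: h_def pderiv_pcompose poly_pcompose l pderiv_pCons)
  finally have b: "b = p * l" .
  have q0: "q \<noteq> 0" using h irr by (auto simp: hw wq split: if_splits)
  have q: "lead_coeff q = 1" using h(1) q0 by (simp add: hw wq)
  have w: "lead_coeff w = 1" "degree g = Suc (degree w)" using h q0 by (simp_all add: hw wq)
  define y where "y = \<theta> - of_int x0"
  have "ieval y h = 0" using g(2) by (simp add: h_def ieval_pcompose_linear y_def)
  then have y1: "ieval y (pCons (p\<^sup>2 * m) (pCons (p * l) q)) = 0" by (simp add: hw wq a b)
  have y0: "y \<noteq> 0"
  proof
    assume "y = 0"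
    then have "ieval \<theta> [:- x0, 1:] = 0"
      by (simp add: y_def of_int_hom.map_poly_pCons_hom)
    then have "g dvd [:- x0, 1:]" by (rule ieval_kernel[OF irr(1) dg g(2)])
    then show False using irr dvd_imp_degree_le[of g "[:- x0, 1:]"] by simp
  qed
  \<comment> \<open>Shifting back gives \<open>W(\<theta>) = w(y)\<close>.\<close>
  define W where "W = pcompose w [:- x0, 1:]"
  have "lead_coeff W = lead_coeff w * lead_coeff [:- x0, 1:] ^ degree w"
    unfolding W_def by (rule lead_coeff_comp) simp
  then have W: "lead_coeff W = 1" "degree W = degree w"
    using w by (simp_all add: W_def degree_pcompose)
  have "ieval \<theta> W = ieval y w" by (simp add: W_def ieval_pcompose_linear y_def)
  moreover have "of_int (p\<^sup>2 * m) + y * ieval y w = 0"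
    using y1 unfolding wq b by (simp add: of_int_hom.map_poly_pCons_hom)
  ultimately have "y * ieval \<theta> W = - (of_int p * of_int (p * m))"
    by (simp add: power2_eq_square neg_eq_iff_add_eq_0 eq_neg_iff_add_eq_0 mult.assoc add.commute)
  then have \<beta>: "of_int (p * m) / y = ieval \<theta> (- W) / of_int p"
    unfolding ieval_minus using y0 p0 by (simp add: field_simps)
  have "ieval \<theta> (- W) / of_int p \<in> ring_of_integers (rat_field_gen \<theta>)"
    using algebraic_int_of_double_root[OF q y0 y1] ieval_divide_in_rat_field_gen[OF p0]
    unfolding \<beta> ring_of_integers_def by simp
  moreover have "ieval \<theta> (- W) / of_int p \<notin> int_ring_gen \<theta>"
  proof
    assume "ieval \<theta> (- W) / of_int p \<in> int_ring_gen \<theta>"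
    then obtain f where f: "ieval \<theta> (- W) / of_int p = ieval \<theta> f"
      by (auto simp: int_ring_gen_def)
    \<comment> \<open>Reducing \<open>f\<close> modulo \<open>g\<close> makes \<open>W + p r\<close>
      a polynomial of degree below \<open>degree g\<close> that vanishes at \<theta>, hence zero;
      but its coefficient at \<open>degree W\<close> is 1 modulo \<open>p\<close>.\<close>
    obtain s r where sr: "f = g * s + r" "degree r < degree g"
      using monic_division[OF g(1) dg] .
    have "ieval \<theta> f = ieval \<theta> r" using g(2) by (simp add: sr ieval_simps)
    then have "ieval \<theta> (W + [:p:] * r) = 0"
      using f p0 unfolding ieval_simps by (simp add: field_simps neg_eq_iff_add_eq_0)
    then have "g dvd W + [:p:] * r" by (rule ieval_kernel[OF irr(1) dg g(2)])
    moreover have "degree (W + [:p:] * r) < degree g"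
      using W w sr(2) by (intro degree_add_less) (auto intro: le_less_trans[OF degree_smult_le])
    ultimately have Wr: "W + [:p:] * r = 0"
      using dvd_imp_degree_le[of g "W + [:p:] * r"] by (metis not_le)
    have "coeff (W + [:p:] * r) (degree W) = 0" unfolding Wr by simp
    then have "coeff W (degree W) + p * coeff r (degree W) = 0" by simp
    then have "1 = p * (- coeff r (degree W))" using W by simp
    then have "p dvd 1" by (metis dvd_triv_left)
    then show False using p by auto
  qed
  ultimately show ?thesis by blast
qed

section \<open>The quintic\<close>

lemma const_in_prime_ideal:
  fixes p a :: int
  assumes "prime p" "is_prime_ideal M" "[:p:] \<in> M" "[:a:] \<in> M"
  shows "p dvd a"
proof (rule ccontr)
  have id: "is_ideal M" using assms by (simp add: is_prime_ideal_def)
  assume "\<not> p dvd a"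
  then have "Rings.coprime p a" using \<open>prime p\<close> by (metis prime_imp_coprime)
  then obtain u v where "u * p + v * a = 1" by (metis bezout_int coprime_iff_gcd_eq_1)
  then have "1 = [:u:] * [:p:] + [:v:] * [:a:]" by (simp add: one_pCons mult.commute)
  also have "\<dots> \<in> M" by (intro is_idealD(2,3) id assms)
  finally show False using assms by (simp add: is_prime_ideal_def)
qed

text \<open>Modulo \<open>x - x0\<close>, \<open>f\<close> becomes the constant
  \<open>f(x0)\<close>, and the constants in \<open>M\<close> are the multiples of
  \<open>p\<close>.\<close>

lemma eval_in_linear_prime_ideal:
  fixes p x0 :: int
  assumes "prime p" "is_prime_ideal M" "[:p:] \<in> M" "[:- x0, 1:] \<in> M" "f \<in> M"
  shows "p dvd poly f x0"
proof -
  have id: "is_ideal M" using assms by (simp add: is_prime_ideal_def)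
  have "[:poly f x0:] = f - [:- x0, 1:] * synthetic_div f x0"
    using synthetic_div_correct'[of x0 f] by (simp add: algebra_simps)
  also have "\<dots> \<in> M" by (intro is_ideal_diff is_idealD(4) id assms)
  finally show ?thesis using const_in_prime_ideal assms by blast
qed

text \<open>The left side concerns \<open>g(-d)\<close>. With \<open>r = d mod 5\<close>,
  \<open>d^5\<close> is \<open>r^5\<close> modulo 25, and \<open>c d^4\<close> is \<open>c\<close>
  because \<open>5 dvd c\<close> and \<open>r^4\<close> is 1 modulo 5. The listed residues are
  \<open>1^5\<close>, \<open>2^5\<close>, \<open>3^5\<close>, \<open>4^5\<close> modulo 25.\<close>

lemma teichmueller_mod_25:
  fixes c d :: int
  assumes "5 dvd c" "\<not> 5 dvd d"
  shows "25 dvd d + c * d ^ 4 - d ^ 5 \<longleftrightarrow> (c + d) mod 25 \<in> {1, 7, 18, 24}"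
proof -
  obtain a where a: "c = 5 * a" using assms by auto
  define b r where "b = d div 5" and "r = d mod 5"
  have d: "d = 5 * b + r" by (simp add: b_def r_def)
  have r: "r \<in> {1, 2, 3, 4}"
    using assms(2) by (auto simp: r_def dvd_eq_mod_eq_0)
  \<comment> \<open>These are the terms divisible by 25 in the binomial expansions of
    \<open>c d^4\<close> and \<open>d^5\<close> at \<open>d = 5 b + r\<close>, divided by
    25.\<close>
  define K where "K = a * (4 * b * r ^ 3 + 30 * b ^ 2 * r ^ 2 + 100 * b ^ 3 * r + 125 * b ^ 4)
    - (b * r ^ 4 + 10 * b ^ 2 * r ^ 3 + 50 * b ^ 3 * r ^ 2 + 125 * b ^ 4 * r + 125 * b ^ 5)"
  have "d + c * d ^ 4 - d ^ 5 = (5 * b + r - r ^ 5) + 5 * a * r ^ 4 + 25 * K"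
    unfolding a d K_def by (simp add: eval_nat_numeral algebra_simps)
  also obtain k where "r ^ 4 = 1 + 5 * k"
    using r that[of "(r ^ 4 - 1) div 5"] by fastforce
  then have "(5 * b + r - r ^ 5) + 5 * a * r ^ 4 + 25 * K = (c + d) - r ^ 5 + 25 * (a * k + K)"
    by (simp add: a d algebra_simps)
  finally have eq: "d + c * d ^ 4 - d ^ 5 = (c + d) - r ^ 5 + 25 * (a * k + K)" .
  have "25 dvd d + c * d ^ 4 - d ^ 5 \<longleftrightarrow> (c + d) mod 25 = r ^ 5 mod 25"
    unfolding eq mod_eq_dvd_iff by (rule dvd_add_left_iff) simp
  \<comment> \<open>The four residues differ modulo 5, so membership in the list already selects
    \<open>r^5 mod 25\<close>.\<close>
  moreover have "(c + d) mod 25 mod 5 = r" by (simp add: a r_def mod_mod_cancel)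
  ultimately show ?thesis
    using r by (elim insertE emptyE) auto
qed

text \<open>Second-order vanishing of \<open>g\<close> at \<open>M\<close> leaves three candidates:
  \<open>x0 = 0\<close> contradicts \<open>d\<close>, \<open>x0 = -d\<close> contradicts
  \<open>cd\<close>, and \<open>x0 = -4c/5\<close> modulo \<open>p^2\<close> contradicts
  \<open>sqf\<close>.\<close>

lemma quintic_regular:
  fixes c d p :: int
  defines "g \<equiv> [:d, 0, 0, 0, c, 1:]"
  assumes sqf: "squarefree ((5^5 * d + 2^8 * c^5) div gcd (5^5 * d) (2^8 * c^5))"
    and d: "squarefree d"
    and cd: "5 dvd c \<and> \<not> 5 dvd d \<longrightarrow> (c + d) mod 25 \<notin> {1, 7, 18, 24}"
    and p: "prime p" and M: "is_prime_ideal M" "[:p:] \<in> M"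
    and hkt: "h \<in> M" "k \<in> M" "t \<in> M" "g = h * k + [:p:] * t"
  shows False
proof -
  have id: "is_ideal M" and pr: "\<And>a b. a * b \<in> M \<Longrightarrow> a \<in> M \<or> b \<in> M"
    using M by (simp_all add: is_prime_ideal_def)
  have gM: "g \<in> M" unfolding hkt(4) by (intro is_idealD id hkt)
  have constM: "[:a:] \<in> M" if "p dvd a" for a
  proof -
    obtain b where "a = p * b" using \<open>p dvd a\<close> by auto
    then have "[:a:] = [:b:] * [:p:]" by simp
    then show ?thesis using is_idealD(3)[OF id M(2)] by metis
  qed
  \<comment> \<open>The values of \<open>h\<close>, \<open>k\<close> and \<open>t\<close> at
    \<open>x0\<close> are all divisible by \<open>p\<close>, so \<open>h k + p t\<close> gains a
    factor \<open>p^2\<close>.\<close>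
  have sq: "p\<^sup>2 dvd poly g x0" if "[:- x0, 1:] \<in> M" for x0
  proof -
    have "p dvd poly f x0" if "f \<in> M" for f
      using eval_in_linear_prime_ideal[OF p M \<open>[:- x0, 1:] \<in> M\<close> that] .
    then have "p * p dvd poly h x0 * poly k x0" "p * p dvd p * poly t x0"
      by (simp_all add: hkt mult_dvd_mono)
    then show ?thesis by (simp add: hkt(4) power2_eq_square)
  qed
  let ?X = "[:0, 1:] :: int poly"
  let ?L = "[:4 * c, 5:]"
  have "pderiv g = (pderiv h * k + h * pderiv k) + [:p:] * pderiv t"
    unfolding hkt(4) by (simp add: pderiv_add pderiv_mult pderiv_smult)
  also have "\<dots> \<in> M"
    by (intro is_idealD(2)[OF id] is_idealD(3)[OF id hkt(2)] is_idealD(4)[OF id hkt(1)]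
        is_idealD(4)[OF id M(2)])
  finally have "pderiv g \<in> M" .
  also have "pderiv g = ?X ^ 3 * ?L"
    by (simp add: g_def pderiv_pCons eval_nat_numeral)
  finally have "?X \<in> M \<or> ?L \<in> M"
    using pr is_prime_ideal_power[OF M(1)] by blast
  moreover have X: "?X \<notin> M"
  proof
    assume "?X \<in> M"
    then have "p\<^sup>2 dvd d" using sq[of 0] by (simp add: g_def)
    then show False using d p by (auto simp: squarefree_def)
  qed
  ultimately have L: "?L \<in> M" by blast
  have pd: "\<not> p dvd d"
  proof
    assume "p dvd d"
    \<comment> \<open>With \<open>p dvd d\<close>, both \<open>x + c\<close> and
      \<open>5x + 4c\<close> would lie in \<open>M\<close>, and hence \<open>x\<close> as
      well.\<close>
    have "?X ^ 4 * [:c, 1:] = g - [:d:]" by (simp add: g_def eval_nat_numeral)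
    also have "\<dots> \<in> M" by (intro is_ideal_diff id gM constM \<open>p dvd d\<close>)
    finally have c1: "[:c, 1:] \<in> M" using pr is_prime_ideal_power[OF M(1)] X by blast
    have "?X = (?L - [:4:] * [:c, 1:])" by simp
    also have "\<dots> \<in> M" by (intro is_ideal_diff is_idealD(3) id L c1)
    finally show False using X by simp
  qed
  define D where "D = 5^5 * d + 2^8 * c^5"
  \<comment> \<open>\<open>s\<close> is the quotient of \<open>5^5 g\<close> by
    \<open>5x + 4c\<close>; the remainder is \<open>D = 5^5 g(-4c/5)\<close>.\<close>
  define s where "s = [:- 64 * c^4, 80 * c^3, - 100 * c^2, 125 * c, 625:]"
  have Dg: "[:5^5:] * g = ?L * s + [:D:]"
    by (simp add: g_def s_def D_def eval_nat_numeral)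
  then have "[:D:] = [:5^5:] * g - s * ?L" by (simp add: algebra_simps)
  also have "\<dots> \<in> M" by (intro is_ideal_diff is_idealD(3) id L gM)
  finally have pD: "p dvd D" using const_in_prime_ideal[OF p M] by blast
  show False
  proof (cases "p = 5")
    case True
    have "5 dvd 2^8 * c^5"
      using pD unfolding D_def True by (metis dvd_add_right_iff dvd_mult2 dvd_power zero_less_numeral)
    then have c5: "5 dvd c"
      using p prime_dvd_power[of 5 c 5] unfolding True by (auto simp: prime_dvd_mult_iff)
    obtain b where b: "c = 5 * b" using c5 by auto
    have "d ^ 5 mod 5 = d mod 5"
    proof -
      have "d mod 5 \<in> {0, 1, 2, 3, 4}" by auto
      then have "(d mod 5) ^ 5 mod 5 = d mod 5" by auto
      then show ?thesis by (simp add: power_mod)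
    qed
    then have "5 dvd d ^ 5 - d" by (simp add: mod_eq_dvd_iff)
    then obtain e where e: "d ^ 5 - d = 5 * e" by auto
    \<comment> \<open>As \<open>5 dvd c\<close> and \<open>d^5\<close> is \<open>d\<close> modulo 5,
      \<open>g\<close> agrees with \<open>(x + d)^5\<close> modulo 5; the list is their difference
      divided by 5.\<close>
    have "[:d, 1:] ^ 5 = g + [:e, d^4, 2 * d^3, 2 * d^2, d - b:] * [:p:]"
      using e by (simp add: g_def True b eval_nat_numeral algebra_simps)
    also have "\<dots> \<in> M" by (intro is_idealD(2,3) id gM M)
    finally have "[:d, 1:] \<in> M" by (rule is_prime_ideal_power[OF M(1)])
    then have "5\<^sup>2 dvd poly g (- d)" using sq[of "- d"] by (simp add: True)
    also have "poly g (- d) = d + c * d ^ 4 - d ^ 5"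
      by (simp add: g_def eval_nat_numeral algebra_simps)
    finally show False
      using teichmueller_mod_25[OF c5] cd pd c5 True by simp
  next
    case False
    have p5: "prime (5 :: int)" by simp
    have "Rings.coprime 5 (p\<^sup>2)"
      using primes_coprime[OF p5 p] False by simp
    then obtain e q where eq: "e * 5 + q * p\<^sup>2 = 1"
      by (metis bezout_int coprime_iff_gcd_eq_1)
    \<comment> \<open>Since \<open>e\<close> inverts 5 modulo \<open>p^2\<close>, not just modulo
      \<open>p\<close>, \<open>4c + 5 x0\<close> is divisible by \<open>p^2\<close>, and
      \<open>p^2 dvd g(x0)\<close> carries over to \<open>D\<close>.\<close>
    define x0 where "x0 = - 4 * c * e"
    have e5: "5 * e - 1 = - (q * p\<^sup>2)" using eq by simp
    have "[:- x0, 1:] = [:e:] * ?L - [:5 * e - 1:] * ?X"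
      by (simp add: x0_def)
    also have "\<dots> \<in> M"
      by (intro is_ideal_diff is_idealD(3)[OF id L] is_idealD(4)[OF id] id constM) (simp add: e5 power2_eq_square)
    finally have "p\<^sup>2 dvd poly g x0" by (rule sq)
    moreover have "5^5 * poly g x0 = (4 * c + 5 * x0) * poly s x0 + D"
      using arg_cong[OF Dg, of "\<lambda>f. poly f x0"] by (simp add: algebra_simps)
    moreover have "4 * c + 5 * x0 = 4 * c * q * p\<^sup>2"
    proof -
      have "4 * c + 5 * x0 = - 4 * c * (5 * e - 1)" by (simp add: x0_def algebra_simps)
      then show ?thesis unfolding e5 by simp
    qed
    ultimately have D2: "p\<^sup>2 dvd D"
      by (metis dvd_add_right_iff dvd_mult dvd_mult2 dvd_triv_right)
    \<comment> \<open>Because \<open>p\<close> divides neither 5 nor \<open>d\<close>, it does not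
      divide \<open>G\<close>, and the square factor of \<open>D\<close> survives in
      \<open>D div G\<close>.\<close>
    define G where "G = gcd (5^5 * d) (2^8 * c^5)"
    have "G dvd D" by (simp add: G_def D_def)
    then have DG: "D = G * (D div G)" by simp
    have "\<not> p dvd G"
    proof
      assume "p dvd G"
      then have "p dvd 5^5 * d" by (simp add: G_def)
      then have "p dvd 5^5" using pd p prime_dvd_multD by blast
      then have "p dvd 5" by (rule prime_dvd_power[OF p])
      then show False using primes_dvd_imp_eq[OF p p5] False by simp
    qed
    then have "Rings.coprime (p\<^sup>2) G" using prime_imp_coprime[OF p] by simp
    then have "p\<^sup>2 dvd D div G" using D2 DG by (metis coprime_dvd_mult_right_iff)
    moreover have "squarefree (D div G)" using sqf by (simp only: D_def G_def)
    ultimately show False using p by (auto simp: squarefree_def)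
  qed
qed

section \<open>Both directions of the criterion for the quintic\<close>

theorem theorem3p3:
  fixes c d :: int and \<theta> :: complex
  defines "g \<equiv> [:d, 0, 0, 0, c, 1:]"
  assumes irr: "irreducible g"
    and root: "poly (map_poly of_int g) \<theta> = 0"
    and sqf: "squarefree ((5^5 * d + 2^8 * c^5) div gcd (5^5 * d) (2^8 * c^5))"
  shows "int_ring_gen \<theta> = ring_of_integers (rat_field_gen \<theta>) \<longleftrightarrow>
           squarefree d \<and>
           ((5 dvd c \<and> \<not> 5 dvd d) \<longrightarrow> (c + d) mod 25 \<notin> {1, 7, 18, 24})"
proof
  have g: "lead_coeff g = 1" "degree g = 5" by (simp_all add: g_def)
  note not_closed = not_integrally_closed_at_double_root[OF irr _ g(1) root]
  assume eq: "int_ring_gen \<theta> = ring_of_integers (rat_field_gen \<theta>)"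
  have "squarefree d"
  proof (rule ccontr)
    assume "\<not> squarefree d"
    then obtain x where x: "x\<^sup>2 dvd d" "\<not> x dvd 1" by (auto simp: squarefree_def)
    \<comment> \<open>For \<open>x = 0\<close> any prime will do, and 2 is taken.\<close>
    obtain p where p: "prime p" "p dvd x"
      using x(2) prime_divisor_exists[of x] that[of 2] by (cases "x = 0") auto
    then have "p\<^sup>2 dvd d" using x(1) dvd_power_same dvd_trans by blast
    \<comment> \<open>The double root modulo \<open>p\<close> is 0: \<open>g(0) = d\<close> and
      \<open>g'(0) = 0\<close>.\<close>
    then show False
      using not_closed[of p 0] p eq g by (simp add: g_def pderiv_pCons)
  qed
  moreover have "(c + d) mod 25 \<notin> {1, 7, 18, 24}" if "5 dvd c" "\<not> 5 dvd d"
  proof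
    assume "(c + d) mod 25 \<in> {1, 7, 18, 24}"
    then have "25 dvd d + c * d ^ 4 - d ^ 5" using teichmueller_mod_25 that by blast
    also have "d + c * d ^ 4 - d ^ 5 = poly g (- d)"
      by (simp add: g_def eval_nat_numeral algebra_simps)
    finally have "5\<^sup>2 dvd poly g (- d)" by simp
    \<comment> \<open>All coefficients of \<open>g' = 5 x^4 + 4 c x^3\<close> are divisible by
      5.\<close>
    moreover have "5 dvd poly (pderiv g) (- d)"
      using that by (auto simp: g_def pderiv_pCons)
    ultimately show False using not_closed[of 5 "- d"] eq g by simp
  qed
  ultimately show "squarefree d \<and>
      ((5 dvd c \<and> \<not> 5 dvd d) \<longrightarrow> (c + d) mod 25 \<notin> {1, 7, 18, 24})" by blast
next
  have g: "lead_coeff g = 1" "degree g > 0" by (simp_all add: g_def)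
  assume "squarefree d \<and> ((5 dvd c \<and> \<not> 5 dvd d) \<longrightarrow> (c + d) mod 25 \<notin> {1, 7, 18, 24})"
  then have reg: False
    if "prime p" "is_prime_ideal M" "[:p:] \<in> M" "h \<in> M" "k \<in> M" "t \<in> M" "g = h * k + [:p:] * t"
    for p M h k t
    using quintic_regular[OF sqf, of p M h k t] that unfolding g_def by blast
  show "int_ring_gen \<theta> = ring_of_integers (rat_field_gen \<theta>)"
  proof
    show "int_ring_gen \<theta> \<subseteq> ring_of_integers (rat_field_gen \<theta>)"
      using algebraic_int_ieval[OF g root] ieval_divide_in_rat_field_gen[of 1 _ \<theta>]
      by (auto simp: int_ring_gen_def ring_of_integers_def)
    show "ring_of_integers (rat_field_gen \<theta>) \<subseteq> int_ring_gen \<theta>"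
      using integral_in_int_ring_gen[OF irr g(2,1) root reg] algebraic_int_imp_integral_over
      by (auto simp: ring_of_integers_def)
  qed
qed

end
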